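(* Let $t,u$ be positive integers. Then there exist $\alpha=\alpha(t,u)>0$ and $\beta=\beta(u)>0$ (the latter depending only on $u$) such that for every positive integer $n$, $$R_{t,u}(n)\leq \alpha n^{\beta}.$$
   Context: A function $f:\mathbb{R}^{m}\to\mathbb{R}$ is linear if $f(\mathbf{x})=b+\sum_{i=1}^m a_i\mathbf{x}(i)$ for some reals $a_1,\dots,a_m,b$. A finite simple graph $G$ is semilinear* of complexity $(t,u)$ if $V(G)\subset\mathbb{R}^d$ for some positive integer $d$ and there are $tu$ linear functions $f_{i,j}:\mathbb{R}^d\times\mathbb{R}^d\to\mathbb{R}$, $(i,j)\in[u]\times[t]$, such that for distinct $\mathbf{x},\mathbf{y}\in V(G)$, $\{\mathbf{x},\mathbf{y}\}$ is an edge iff $\bigvee_{i\in[u]}\bigwedge_{j\in[t]}\{f_{i,j}(\mathbf{x},\mathbf{y})<0\}$ is true; it is assumed that this truth value is unchanged when $\mathbf{x}$ and $\mathbf{y}$ are swapped. $R_{t,u}(n)$ denotes the smallest $N$ such that every semilinear* graph of complexity $(t,u)$ on $N$ vertices contains a clique or an independent set of size $n$. *)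

theory Defs
  imports Complex_Main
begin

text \<open>Points of R^d are represented as functions nat => real vanishing at all
coordinates k >= d. A linear function f on R^d x R^d is given by 2d+1 reals:
f(x,y) = b + sum_{k<d} a k * x k + sum_{k<d} a (d+k) * y k.
The tu linear functions f_{i,j}, (i,j) in [u] x [t], are indexed 0-based by
i < u, j < t, with coefficients A i j and constant terms B i j.\<close>

definition lin_fun :: "nat \<Rightarrow> (nat \<Rightarrow> real) \<Rightarrow> real \<Rightarrow> (nat \<Rightarrow> real) \<Rightarrow> (nat \<Rightarrow> real) \<Rightarrow> real" where
  "lin_fun d a b x y = b + (\<Sum>k<d. a k * x k) + (\<Sum>k<d. a (d + k) * y k)"

definition sl_formula ::
  "nat \<Rightarrow> nat \<Rightarrow> nat \<Rightarrow> (nat \<Rightarrow> nat \<Rightarrow> nat \<Rightarrow> real) \<Rightarrow> (nat \<Rightarrow> nat \<Rightarrow> real)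
     \<Rightarrow> (nat \<Rightarrow> real) \<Rightarrow> (nat \<Rightarrow> real) \<Rightarrow> bool" where
  "sl_formula t u d A B x y = (\<exists>i<u. \<forall>j<t. lin_fun d (A i j) (B i j) x y < 0)"

definition semilinear_graph ::
  "nat \<Rightarrow> nat \<Rightarrow> nat \<Rightarrow> (nat \<Rightarrow> real) set \<Rightarrow> (nat \<Rightarrow> nat \<Rightarrow> nat \<Rightarrow> real) \<Rightarrow> (nat \<Rightarrow> nat \<Rightarrow> real) \<Rightarrow> bool" where
  "semilinear_graph t u d V A B \<longleftrightarrow>
     0 < d \<and> finite V \<and> (\<forall>x\<in>V. \<forall>k\<ge>d. x k = 0) \<and>
     (\<forall>x\<in>V. \<forall>y\<in>V. x \<noteq> y \<longrightarrow> (sl_formula t u d A B x y \<longleftrightarrow> sl_formula t u d A B y x))"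

definition sl_edge ::
  "nat \<Rightarrow> nat \<Rightarrow> nat \<Rightarrow> (nat \<Rightarrow> nat \<Rightarrow> nat \<Rightarrow> real) \<Rightarrow> (nat \<Rightarrow> nat \<Rightarrow> real)
     \<Rightarrow> (nat \<Rightarrow> real) \<Rightarrow> (nat \<Rightarrow> real) \<Rightarrow> bool" where
  "sl_edge t u d A B x y \<longleftrightarrow> x \<noteq> y \<and> sl_formula t u d A B x y"

definition has_clique_or_indep ::
  "nat \<Rightarrow> (('a \<Rightarrow> 'a \<Rightarrow> bool)) \<Rightarrow> 'a set \<Rightarrow> bool" where
  "has_clique_or_indep n E V \<longleftrightarrow>
     (\<exists>S\<subseteq>V. card S = n \<and>
        ((\<forall>x\<in>S. \<forall>y\<in>S. x \<noteq> y \<longrightarrow> E x y) \<or> (\<forall>x\<in>S. \<forall>y\<in>S. x \<noteq> y \<longrightarrow> \<not> E x y)))"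

definition R_sl :: "nat \<Rightarrow> nat \<Rightarrow> nat \<Rightarrow> nat" where
  "R_sl t u n = (LEAST N. \<forall>d V A B. semilinear_graph t u d V A B \<and> card V = N
                   \<longrightarrow> has_clique_or_indep n (sl_edge t u d A B) V)"

end

theory Submission
  imports Defs "HOL-Library.FuncSet"
begin

text \<open>Each atomic formula has the form \<open>f x < g y\<close>, and replacing values by their ranks among the
values of \<open>g\<close> makes \<open>f\<close> and \<open>g\<close> natural numbers at most \<open>card V\<close>. Where \<open>g x \<le> f x\<close> the relation is
transitive. Where \<open>f x < g x\<close>, sort the vertices by the highest binary digit in which \<open>f x\<close> and \<open>g x\<close>
differ: among vertices with the same such digit, \<open>f x < g y\<close> compares the digits of \<open>f x\<close> and \<open>f y\<close> above
it, hence is again transitive. Since there are only logarithmically many digits, by pigeonhole a set \<open>W\<close> of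
\<open>N / (log N) ^ O(tu)\<close> vertices remains on which all atoms, hence all \<open>u\<close> conjunctions, are
transitive. A chain of such a conjunction is a clique, because the edge relation is symmetric, so if
there is no clique of size \<open>n\<close>, applying Mirsky's theorem to the \<open>u\<close> conjunctions gives an
independent set of size at least \<open>card W / n ^ u\<close>. The logarithmic factor is absorbed by doubling
the exponent \<open>u + 1\<close>, at the price of a constant depending on \<open>t\<close>.\<close>

subsection \<open>Large sets on which threshold relations are transitive\<close>

definition lower_count :: "('a \<Rightarrow> 'b::linorder) \<Rightarrow> 'a set \<Rightarrow> 'b \<Rightarrow> nat" where
  "lower_count g V p = card {x\<in>V. g x \<le> p}"

lemma lower_count_le_card: "finite V \<Longrightarrow> lower_count g V p \<le> card V"
  unfolding lower_count_def by (rule card_mono) auto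

lemma lower_count_less_iff:
  assumes "finite V" "y \<in> V"
  shows "lower_count g V p < lower_count g V (g y) \<longleftrightarrow> p < g y"
proof
  assume "p < g y"
  then have "{x\<in>V. g x \<le> p} \<subseteq> {x\<in>V. g x \<le> g y}"
      "y \<in> {x\<in>V. g x \<le> g y} - {x\<in>V. g x \<le> p}"
    using assms(2) by auto
  then have "{x\<in>V. g x \<le> p} \<subset> {x\<in>V. g x \<le> g y}" by blast
  then show "lower_count g V p < lower_count g V (g y)"
    unfolding lower_count_def using assms(1) by (intro psubset_card_mono) auto
next
  assume less: "lower_count g V p < lower_count g V (g y)"
  show "p < g y"
  proof (rule ccontr)
    assume "\<not> p < g y"
    then have "lower_count g V (g y) \<le> lower_count g V p"
      unfolding lower_count_def using assms(1) by (intro card_mono) auto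
    with less show False by simp
  qed
qed

text \<open>For \<open>m < n\<close> the highest binary digit in which \<open>m\<close> and \<open>n\<close> differ is at position
\<open>dyadic_level m n - 1\<close>; the level is 0 if \<open>n \<le> m\<close>.\<close>

definition dyadic_level :: "nat \<Rightarrow> nat \<Rightarrow> nat" where
  "dyadic_level m n = (LEAST e. n div 2 ^ e \<le> m div 2 ^ e)"

lemma dyadic_level_le: "n < 2 ^ k \<Longrightarrow> dyadic_level m n \<le> k"
  unfolding dyadic_level_def by (rule Least_le) simp

lemma div_dyadic_level_le: "n div 2 ^ dyadic_level m n \<le> m div 2 ^ dyadic_level m n"
  unfolding dyadic_level_def by (rule LeastI[of _ n]) simp

lemma dyadic_level_SucD:
  assumes "dyadic_level m n = Suc e"
  shows "even (m div 2 ^ e)" "n div 2 ^ e = Suc (m div 2 ^ e)"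
proof -
  have "n div 2 ^ Suc e \<le> m div 2 ^ Suc e"
    using div_dyadic_level_le[of n m] by (simp only: assms)
  then have "n div 2 ^ e div 2 \<le> m div 2 ^ e div 2"
    by (simp only: power_Suc2 div_mult2_eq)
  moreover have "m div 2 ^ e < n div 2 ^ e"
    using not_less_Least[of e "\<lambda>e. n div 2 ^ e \<le> m div 2 ^ e"] assms
    by (simp add: dyadic_level_def)
  moreover have "even a \<and> b = Suc a" if "b div 2 \<le> a div 2" "a < b" for a b :: nat
    using that by presburger
  ultimately show "even (m div 2 ^ e)" "n div 2 ^ e = Suc (m div 2 ^ e)"
    by blast+
qed

lemma less_iff_div_le_if_dyadic_level_Suc:
  assumes "dyadic_level m n = Suc e" "dyadic_level m' n' = Suc e"
  shows "m < n' \<longleftrightarrow> m div 2 ^ e \<le> m' div 2 ^ e"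
proof
  assume "m < n'"
  then have "m div 2 ^ e \<le> Suc (m' div 2 ^ e)"
    using div_le_mono[of m n' "2 ^ e"] dyadic_level_SucD(2)[OF assms(2)] by simp
  then show "m div 2 ^ e \<le> m' div 2 ^ e"
    using dyadic_level_SucD(1)[OF assms(1)] dyadic_level_SucD(1)[OF assms(2)]
    by (metis even_Suc le_Suc_eq)
next
  assume "m div 2 ^ e \<le> m' div 2 ^ e"
  then have "m div 2 ^ e < n' div 2 ^ e"
    using dyadic_level_SucD(2)[OF assms(2)] by simp
  then show "m < n'"
    using div_le_mono[of n' m "2 ^ e"] by (meson not_le)
qed

lemma transp_on_dyadic_level:
  fixes f g :: "'a \<Rightarrow> nat"
  shows "transp_on {x. dyadic_level (f x) (g x) = l} (\<lambda>x y. f x < g y)"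
proof (cases l)
  case 0
  have "g x \<le> f x" if "dyadic_level (f x) (g x) = 0" for x
    using div_dyadic_level_le[of "g x" "f x"] that by simp
  moreover have "transp_on {x. g x \<le> f x} (\<lambda>x y. f x < g y)"
    by (rule transp_onI) force
  ultimately show ?thesis
    unfolding 0 by (elim transp_on_subset) auto
next
  case (Suc e)
  have "f x < g y \<longleftrightarrow> f x div 2 ^ e \<le> f y div 2 ^ e"
    if "dyadic_level (f x) (g x) = l" "dyadic_level (f y) (g y) = l" for x y
    using less_iff_div_le_if_dyadic_level_Suc that unfolding Suc .
  then show ?thesis
    by (intro transp_onI) (auto intro: le_trans)
qed

lemma ex_transp_on_coloring:
  fixes f g :: "'a \<Rightarrow> 'b::linorder"
  assumes "finite V" "card V < 2 ^ k"
  shows "\<exists>c \<in> V \<rightarrow> {..k}. \<forall>l. transp_on {x\<in>V. c x = l} (\<lambda>x y. f x < g y)"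
proof
  define F where "F x = lower_count g V (f x)" for x
  define G where "G x = lower_count g V (g x)" for x
  have "G x < 2 ^ k" for x
    using lower_count_le_card[OF assms(1), of g "g x"] assms(2) by (simp add: G_def)
  then show "(\<lambda>x. dyadic_level (F x) (G x)) \<in> V \<rightarrow> {..k}"
    by (simp add: dyadic_level_le)
  have "f x < g y \<longleftrightarrow> F x < G y" if "y \<in> V" for x y
    using assms(1) that by (simp add: F_def G_def lower_count_less_iff)
  then have "transp_on {x\<in>V. dyadic_level (F x) (G x) = l} (\<lambda>x y. f x < g y) \<longleftrightarrow>
      transp_on {x\<in>V. dyadic_level (F x) (G x) = l} (\<lambda>x y. F x < G y)" for l
    by (simp add: transp_on_def)
  moreover have "transp_on {x\<in>V. dyadic_level (F x) (G x) = l} (\<lambda>x y. F x < G y)" for l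
    by (rule transp_on_subset[OF transp_on_dyadic_level[of F G l]]) auto
  ultimately show "\<forall>l. transp_on {x\<in>V. dyadic_level (F x) (G x) = l} (\<lambda>x y. f x < g y)"
    by blast
qed

lemma ex_large_common_fibre:
  fixes c :: "'i \<Rightarrow> 'a \<Rightarrow> 'b"
  assumes fin: "finite I" "finite V" "finite B"
    and c: "\<And>i. i \<in> I \<Longrightarrow> c i \<in> V \<rightarrow> B"
  obtains W z where "W \<subseteq> V" "card V \<le> card B ^ card I * card W"
    "\<And>i x. i \<in> I \<Longrightarrow> x \<in> W \<Longrightarrow> c i x = z i"
proof (cases "V = {}")
  case True
  then show thesis using that[of "{}"] by simp
next
  case False
  define C where "C x = (\<lambda>i\<in>I. c i x)" for x
  have C: "C \<in> V \<rightarrow> (I \<rightarrow>\<^sub>E B)" using c by (fastforce simp: C_def)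
  with False have "(I \<rightarrow>\<^sub>E B) \<noteq> {}" by blast
  then obtain z where "card V \<le> card (C -` {z} \<inter> V) * card (I \<rightarrow>\<^sub>E B)"
    using pigeonhole_card[OF C fin(2)] fin by (meson finite_PiE)
  moreover have "c i x = z i" if "i \<in> I" "x \<in> C -` {z} \<inter> V" for i x
    using that by (auto simp: C_def)
  ultimately show thesis
    using that[of "C -` {z} \<inter> V" z] fin(1) by (simp add: card_funcsetE mult.commute)
qed

lemma ex_large_transp_on_subset:
  fixes f g :: "'i \<Rightarrow> 'a \<Rightarrow> 'b::linorder"
  assumes fin: "finite I" "finite V" and card: "card V < 2 ^ k"
  obtains W where "W \<subseteq> V" "card V \<le> Suc k ^ card I * card W"
    "\<And>i. i \<in> I \<Longrightarrow> transp_on W (\<lambda>x y. f i x < g i y)"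
proof -
  have "\<forall>i. \<exists>c. c \<in> V \<rightarrow> {..k} \<and> (\<forall>l. transp_on {x\<in>V. c x = l} (\<lambda>x y. f i x < g i y))"
    using ex_transp_on_coloring[OF fin(2) card] by blast
  from choice[OF this] obtain c where c: "\<And>i. c i \<in> V \<rightarrow> {..k}"
    "\<And>i l. transp_on {x\<in>V. c i x = l} (\<lambda>x y. f i x < g i y)"
    by blast
  obtain W z where W: "W \<subseteq> V" "card V \<le> card {..k} ^ card I * card W"
    and fibre: "\<And>i x. i \<in> I \<Longrightarrow> x \<in> W \<Longrightarrow> c i x = z i"
    using ex_large_common_fibre[of I V "{..k}" c] fin c(1) by blast
  have "transp_on W (\<lambda>x y. f i x < g i y)" if "i \<in> I" for i
    by (rule transp_on_subset[OF c(2)[of i "z i"]]) (use W(1) fibre that in auto)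
  then show thesis using that W by simp
qed

subsection \<open>Mirsky's theorem for transitive relations\<close>

definition chains_below :: "('a \<Rightarrow> 'a \<Rightarrow> bool) \<Rightarrow> 'a set \<Rightarrow> 'a \<Rightarrow> 'a set set" where
  "chains_below D V y = {C. C \<subseteq> V \<and> totalp_on C D \<and> (\<forall>x\<in>C. D x y)}"

definition chain_height :: "('a \<Rightarrow> 'a \<Rightarrow> bool) \<Rightarrow> 'a set \<Rightarrow> 'a \<Rightarrow> nat" where
  "chain_height D V y = Max (card ` chains_below D V y)"

lemma finite_chains_below: "finite V \<Longrightarrow> finite (chains_below D V y)"
  by (simp add: chains_below_def)

lemma card_le_chain_height:
  "finite V \<Longrightarrow> C \<in> chains_below D V y \<Longrightarrow> card C \<le> chain_height D V y"
  unfolding chain_height_def by (simp add: finite_chains_below)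

lemma ex_chain_card_Suc_chain_height:
  assumes "finite V" "irreflp_on V D" "y \<in> V"
  obtains C where "C \<subseteq> V" "totalp_on C D" "card C = Suc (chain_height D V y)"
    "\<And>x. x \<in> C \<Longrightarrow> x = y \<or> D x y"
proof -
  have "{} \<in> chains_below D V y" by (simp add: chains_below_def)
  then have "chain_height D V y \<in> card ` chains_below D V y"
    unfolding chain_height_def using assms(1) by (intro Max_in) (auto simp: finite_chains_below)
  then obtain C where C: "C \<subseteq> V" "totalp_on C D" "\<forall>x\<in>C. D x y"
      and card: "card C = chain_height D V y"
    by (auto simp: chains_below_def)
  have "finite C" "y \<notin> C"
    using C assms finite_subset by (auto dest: irreflp_onD)
  then have "card (insert y C) = Suc (chain_height D V y)" using card by simp
  moreover have "totalp_on (insert y C) D" using C by (auto simp: totalp_on_def)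
  ultimately show thesis using that C assms(3) by blast
qed

lemma chain_height_less:
  assumes "finite V" "irreflp_on V D" "transp_on V D" "y \<in> V" "z \<in> V" "D y z"
  shows "chain_height D V y < chain_height D V z"
proof -
  obtain C where C: "C \<subseteq> V" "totalp_on C D" "card C = Suc (chain_height D V y)"
      "\<And>x. x \<in> C \<Longrightarrow> x = y \<or> D x y"
    using ex_chain_card_Suc_chain_height[OF assms(1,2,4)] by blast
  have "D x z" if "x \<in> C" for x
    using transp_onD[OF assms(3), of x y z] C(1,4) that assms(4-6) by blast
  then have "C \<in> chains_below D V z" using C by (simp add: chains_below_def)
  then show ?thesis using card_le_chain_height[OF assms(1)] C(3) by fastforce
qed

lemma ex_irreflp_on_transp_on_refinement:
  assumes fin: "finite V" and tr: "transp_on V D"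
  obtains D' where "transp_on V D'" "irreflp_on V D'" "\<And>x y. D' x y \<Longrightarrow> D x y"
    "\<And>x y. x \<in> V \<Longrightarrow> y \<in> V \<Longrightarrow> x \<noteq> y \<Longrightarrow> D x y \<Longrightarrow> D' x y \<or> D' y x"
proof -
  obtain h :: "'a \<Rightarrow> nat" where h: "inj_on h V"
    using finite_imp_inj_to_nat_seg[OF fin] by blast
  define D' where "D' x y \<longleftrightarrow> D x y \<and> (D y x \<longrightarrow> h x < h y)" for x y
  have "transp_on V D'"
  proof (rule transp_onI)
    fix x y z assume V: "x \<in> V" "y \<in> V" "z \<in> V" and "D' x y" "D' y z"
    then have xy: "D x y" "D y x \<Longrightarrow> h x < h y" and yz: "D y z" "D z y \<Longrightarrow> h y < h z"
      by (auto simp: D'_def)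
    have "h x < h z" if zx: "D z x"
    proof -
      have "D z y" using transp_onD[OF tr, of z x y] V zx xy by blast
      moreover have "D y x" using transp_onD[OF tr, of y z x] V zx yz by blast
      ultimately show ?thesis using xy yz by simp
    qed
    moreover have "D x z" using transp_onD[OF tr, of x y z] V xy yz by blast
    ultimately show "D' x z" by (simp add: D'_def)
  qed
  moreover have "irreflp_on V D'" by (simp add: irreflp_on_def D'_def)
  moreover have "D' x y \<or> D' y x" if "x \<in> V" "y \<in> V" "x \<noteq> y" "D x y" for x y
  proof -
    have "h x \<noteq> h y" using h that by (auto dest: inj_onD)
    then show ?thesis using that(4) by (auto simp: D'_def)
  qed
  moreover have "D x y" if "D' x y" for x y using that by (simp add: D'_def)
  ultimately show thesis using that by blast
qed

lemma mirsky_coloring: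
  assumes fin: "finite V" and tr: "transp_on V D"
    and chain: "\<And>C. C \<subseteq> V \<Longrightarrow> totalp_on C D \<Longrightarrow> card C \<le> m"
  shows "\<exists>h \<in> V \<rightarrow> {..<m}. \<forall>l. pairwise (\<lambda>x y. \<not> D x y) {x\<in>V. h x = l}"
proof -
  obtain D' where D': "transp_on V D'" "irreflp_on V D'" "\<And>x y. D' x y \<Longrightarrow> D x y"
    and comparable: "\<And>x y. x \<in> V \<Longrightarrow> y \<in> V \<Longrightarrow> x \<noteq> y \<Longrightarrow> D x y \<Longrightarrow> D' x y \<or> D' y x"
    using ex_irreflp_on_transp_on_refinement[OF fin tr] by blast
  define h where "h = chain_height D' V"
  have "h y < m" if "y \<in> V" for y
  proof -
    obtain C where "C \<subseteq> V" "totalp_on C D'" "card C = Suc (h y)"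
      unfolding h_def using ex_chain_card_Suc_chain_height[OF fin D'(2) \<open>y \<in> V\<close>] .
    moreover have "totalp_on C D"
      using \<open>totalp_on C D'\<close> D'(3) unfolding totalp_on_def by blast
    ultimately show ?thesis using chain[of C] by simp
  qed
  moreover have "h x \<noteq> h y" if "x \<in> V" "y \<in> V" "x \<noteq> y" "D x y" for x y
    using comparable[OF that] chain_height_less[OF fin D'(2,1)] that(1,2)
    unfolding h_def by fastforce
  then have "pairwise (\<lambda>x y. \<not> D x y) {x\<in>V. h x = l}" for l
    unfolding pairwise_def by blast
  ultimately show ?thesis
    by (intro bexI[of _ h]) auto
qed

subsection \<open>Ramsey bounds\<close>

lemma union_transp_on_ramsey_bound:
  fixes D :: "'i \<Rightarrow> 'a \<Rightarrow> 'a \<Rightarrow> bool"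
  assumes fin: "finite I" "finite V" and sym: "symp_on V E"
    and edge: "\<And>x y. x \<in> V \<Longrightarrow> y \<in> V \<Longrightarrow> x \<noteq> y \<Longrightarrow> E x y \<longleftrightarrow> (\<exists>i\<in>I. D i x y)"
    and tr: "\<And>i. i \<in> I \<Longrightarrow> transp_on V (D i)"
    and clique: "\<And>C. C \<subseteq> V \<Longrightarrow> pairwise E C \<Longrightarrow> card C \<le> p"
    and indep: "\<And>S. S \<subseteq> V \<Longrightarrow> pairwise (\<lambda>x y. \<not> E x y) S \<Longrightarrow> card S \<le> q"
  shows "card V \<le> p ^ card I * q"
proof -
  have "card C \<le> p" if "i \<in> I" "C \<subseteq> V" "totalp_on C (D i)" for i C
  proof (rule clique[OF \<open>C \<subseteq> V\<close>], rule pairwiseI)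
    fix x y assume xy: "x \<in> C" "y \<in> C" "x \<noteq> y"
    then have "D i x y \<or> D i y x" using totalp_onD[OF that(3)] by blast
    then have "E x y \<or> E y x" using xy that edge by blast
    then show "E x y" using symp_onD[OF sym] xy that(2) by blast
  qed
  then have "\<forall>i\<in>I. \<exists>h. h \<in> V \<rightarrow> {..<p} \<and>
      (\<forall>l. pairwise (\<lambda>x y. \<not> D i x y) {x\<in>V. h x = l})"
    using mirsky_coloring[OF fin(2) tr] by blast
  from bchoice[OF this] obtain h where h: "\<And>i. i \<in> I \<Longrightarrow> h i \<in> V \<rightarrow> {..<p}"
    and antichain: "\<And>i l. i \<in> I \<Longrightarrow> pairwise (\<lambda>x y. \<not> D i x y) {x\<in>V. h i x = l}"
    by blast
  obtain S z where S: "S \<subseteq> V" "card V \<le> card {..<p} ^ card I * card S"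
    and fibre: "\<And>i x. i \<in> I \<Longrightarrow> x \<in> S \<Longrightarrow> h i x = z i"
    using ex_large_common_fibre[of I V "{..<p}" h] fin h by blast
  have "pairwise (\<lambda>x y. \<not> D i x y) S" if "i \<in> I" for i
    by (rule pairwise_subset[OF antichain[OF that, of "z i"]]) (use S(1) fibre that in auto)
  then have "pairwise (\<lambda>x y. \<not> E x y) S"
    using edge S(1) by (auto simp: pairwise_def subset_iff)
  then have "card S \<le> q" by (rule indep[OF S(1)])
  then have "card {..<p} ^ card I * card S \<le> p ^ card I * q" by simp
  with S(2) show ?thesis by (rule le_trans)
qed

lemma transp_on_Ball:
  "(\<And>j. j \<in> J \<Longrightarrow> transp_on V (R j)) \<Longrightarrow> transp_on V (\<lambda>x y. \<forall>j\<in>J. R j x y)"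
  unfolding transp_on_def by blast

lemma threshold_formula_ramsey_bound:
  fixes f g :: "'i \<Rightarrow> 'j \<Rightarrow> 'a \<Rightarrow> 'b::linorder"
  assumes fin: "finite I" "finite J" "finite V" and card: "card V < 2 ^ k"
    and sym: "symp_on V E"
    and edge: "\<And>x y. x \<in> V \<Longrightarrow> y \<in> V \<Longrightarrow> x \<noteq> y \<Longrightarrow>
      E x y \<longleftrightarrow> (\<exists>i\<in>I. \<forall>j\<in>J. f i j x < g i j y)"
    and clique: "\<And>C. C \<subseteq> V \<Longrightarrow> pairwise E C \<Longrightarrow> card C \<le> p"
    and indep: "\<And>S. S \<subseteq> V \<Longrightarrow> pairwise (\<lambda>x y. \<not> E x y) S \<Longrightarrow> card S \<le> q"
  shows "card V \<le> Suc k ^ (card I * card J) * (p ^ card I * q)"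
proof -
  obtain W where W: "W \<subseteq> V" "card V \<le> Suc k ^ card (I \<times> J) * card W"
    and atom: "\<And>ij. ij \<in> I \<times> J \<Longrightarrow>
      transp_on W (\<lambda>x y. f (fst ij) (snd ij) x < g (fst ij) (snd ij) y)"
    using ex_large_transp_on_subset[of "I \<times> J" V k "\<lambda>ij. f (fst ij) (snd ij)"
        "\<lambda>ij. g (fst ij) (snd ij)"] fin card by blast
  have "card W \<le> p ^ card I * q"
  proof (rule union_transp_on_ramsey_bound[OF fin(1)])
    show "finite W" using W(1) fin(3) by (rule finite_subset)
    show "symp_on W E" using sym W(1) by (rule symp_on_subset)
    show "E x y \<longleftrightarrow> (\<exists>i\<in>I. \<forall>j\<in>J. f i j x < g i j y)" if "x \<in> W" "y \<in> W" "x \<noteq> y" for x y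
      using edge that W(1) by blast
    show "transp_on W (\<lambda>x y. \<forall>j\<in>J. f i j x < g i j y)" if "i \<in> I" for i
      using atom[of "(i, _)"] that by (intro transp_on_Ball) simp
  qed (use clique indep W(1) in blast)+
  then have "Suc k ^ card (I \<times> J) * card W \<le> Suc k ^ card (I \<times> J) * (p ^ card I * q)"
    by (rule mult_le_mono2)
  with W(2) show ?thesis by (simp only: card_cartesian_product)
qed

lemma card_less_if_not_has_clique_or_indep:
  assumes "\<not> has_clique_or_indep n E V" "S \<subseteq> V"
    and "pairwise E S \<or> pairwise (\<lambda>x y. \<not> E x y) S"
  shows "card S < n"
proof (rule ccontr)
  assume "\<not> card S < n"
  then obtain T where T: "T \<subseteq> S" "card T = n"
    using obtain_subset_with_card_n[of n S] by auto
  then have "pairwise E T \<or> pairwise (\<lambda>x y. \<not> E x y) T"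
    using assms(3) pairwise_subset by blast
  then show False
    using assms(1,2) T unfolding has_clique_or_indep_def pairwise_def by blast
qed

lemma semilinear_graph_ramsey_bound:
  assumes G: "semilinear_graph t u d V A B" and card: "card V < 2 ^ k"
    and no: "\<not> has_clique_or_indep n (sl_edge t u d A B) V"
  shows "card V \<le> Suc k ^ (u * t) * n ^ Suc u"
proof -
  define f where "f i j x = B i j + (\<Sum>k<d. A i j k * x k)" for i j and x :: "nat \<Rightarrow> real"
  define g where "g i j y = - (\<Sum>k<d. A i j (d + k) * y k)" for i j and y :: "nat \<Rightarrow> real"
  have "lin_fun d (A i j) (B i j) x y < 0 \<longleftrightarrow> f i j x < g i j y" for i j x y
    by (auto simp: lin_fun_def f_def g_def)
  then have edge: "sl_edge t u d A B x y \<longleftrightarrow> (\<exists>i\<in>{..<u}. \<forall>j\<in>{..<t}. f i j x < g i j y)"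
    if "x \<noteq> y" for x y
    using that by (simp add: sl_edge_def sl_formula_def Bex_def Ball_def)
  have homogeneous: "card S \<le> n"
    if "S \<subseteq> V"
      and "pairwise (sl_edge t u d A B) S \<or> pairwise (\<lambda>x y. \<not> sl_edge t u d A B x y) S" for S
    using card_less_if_not_has_clique_or_indep[OF no that] by simp
  have "card V \<le> Suc k ^ (card {..<u} * card {..<t}) * (n ^ card {..<u} * n)"
  proof (rule threshold_formula_ramsey_bound[OF _ _ _ card])
    show "finite V" using G by (simp add: semilinear_graph_def)
    show "symp_on V (sl_edge t u d A B)"
      using G by (auto simp: semilinear_graph_def sl_edge_def symp_on_def)
  qed (use edge homogeneous in simp_all)
  then show ?thesis by (simp add: mult.commute)
qed

lemma power_le_self_power_mult_two_power:
  fixes k m :: nat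
  shows "k ^ m \<le> m ^ m * 2 ^ k"
proof (cases "m = 0")
  case False
  have "k = m * (k div m) + k mod m" by simp
  also have "\<dots> \<le> m * (k div m) + m"
    using False by (intro add_left_mono less_imp_le) simp
  also have "\<dots> = m * (k div m + 1)" by simp
  also have "\<dots> \<le> m * 2 ^ (k div m)"
    using less_exp[of "k div m"] by (intro mult_le_mono2) linarith
  finally have "k ^ m \<le> (m * 2 ^ (k div m)) ^ m" by (rule power_mono) simp
  also have "\<dots> = m ^ m * 2 ^ (k div m * m)" by (simp add: power_mult_distrib power_mult)
  also have "\<dots> \<le> m ^ m * 2 ^ k"
    by (intro mult_le_mono2 power_increasing) auto
  finally show ?thesis .
qed simp

definition log_power_const :: "nat \<Rightarrow> nat" where
  "log_power_const a = 4 * (2 * a) ^ (2 * a)"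

lemma le_mult_square_if_le_log_power_mult:
  fixes N M a k :: nat
  assumes "2 ^ k \<le> 2 * N" "N \<le> Suc k ^ a * M"
  shows "N \<le> log_power_const a * M\<^sup>2"
proof (cases "N = 0")
  case False
  have "N * N \<le> (Suc k ^ a * M)\<^sup>2"
    using assms(2) by (simp add: power2_eq_square mult_le_mono)
  also have "\<dots> = Suc k ^ (2 * a) * M\<^sup>2"
    by (simp only: power_mult_distrib power_mult[symmetric] mult.commute)
  also have "\<dots> \<le> (2 * a) ^ (2 * a) * 2 ^ Suc k * M\<^sup>2"
    by (rule mult_le_mono1) (rule power_le_self_power_mult_two_power)
  also have "\<dots> = 2 ^ k * (2 * (2 * a) ^ (2 * a) * M\<^sup>2)" by simp
  also have "\<dots> \<le> 2 * N * (2 * (2 * a) ^ (2 * a) * M\<^sup>2)"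
    using assms(1) by (rule mult_le_mono1)
  also have "\<dots> = N * (log_power_const a * M\<^sup>2)" by (simp add: log_power_const_def)
  finally show ?thesis using False by simp
qed simp

lemma R_sl_le:
  assumes "0 < n"
  shows "R_sl t u n \<le> (log_power_const (u * t) + 1) * n ^ (2 * Suc u)"
proof -
  define N where "N = log_power_const (u * t) * (n ^ Suc u)\<^sup>2 + 1"
  obtain j where j: "2 ^ j \<le> N" "N < 2 ^ Suc j"
    using ex_power_ivl1[of 2 N] by (auto simp: N_def)
  have "has_clique_or_indep n (sl_edge t u d A B) V"
    if G: "semilinear_graph t u d V A B" and V: "card V = N" for d V A B
  proof (rule ccontr)
    assume "\<not> ?thesis"
    then have "N \<le> Suc (Suc j) ^ (u * t) * n ^ Suc u"
      using semilinear_graph_ramsey_bound[OF G, of "Suc j"] V j(2) by simp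
    then have "N \<le> log_power_const (u * t) * (n ^ Suc u)\<^sup>2"
      using j(1) by (intro le_mult_square_if_le_log_power_mult[of "Suc j"]) auto
    then show False by (simp add: N_def)
  qed
  then have "R_sl t u n \<le> N" unfolding R_sl_def by (intro Least_le) blast
  also have "\<dots> \<le> (log_power_const (u * t) + 1) * (n ^ Suc u)\<^sup>2"
    using assms by (simp add: N_def Suc_le_eq)
  also have "(n ^ Suc u)\<^sup>2 = n ^ (2 * Suc u)"
    by (simp only: power_mult[symmetric] mult.commute)
  finally show ?thesis .
qed

theorem theorem1p5:
  fixes u :: nat
  assumes "0 < u"
  shows "\<exists>\<beta>::real. \<beta> > 0 \<and> (\<forall>t::nat. 0 < t \<longrightarrow>
           (\<exists>\<alpha>::real. \<alpha> > 0 \<and> (\<forall>n::nat. 0 < n \<longrightarrow> real (R_sl t u n) \<le> \<alpha> * real n powr \<beta>)))"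
proof -
  define \<alpha> where "\<alpha> t = real (log_power_const (u * t) + 1)" for t
  define \<beta> where "\<beta> = real (2 * Suc u)"
  have "real (R_sl t u n) \<le> \<alpha> t * real n powr \<beta>" if "0 < n" for t n
  proof -
    have "real (R_sl t u n) \<le> real ((log_power_const (u * t) + 1) * n ^ (2 * Suc u))"
      using R_sl_le[OF that] by (rule of_nat_mono)
    also have "\<dots> = \<alpha> t * real n ^ (2 * Suc u)"
      by (simp only: \<alpha>_def of_nat_mult of_nat_power)
    also have "real n ^ (2 * Suc u) = real n powr \<beta>"
      unfolding \<beta>_def using that by (intro powr_realpow[symmetric]) simp
    finally show ?thesis .
  qed
  moreover have "0 < \<beta>" "0 < \<alpha> t" for t by (simp_all add: \<alpha>_def \<beta>_def)
  ultimately show ?thesis by blast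
qed

end
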